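(* Let $p_A,p_B\in[0,1]$ with neither $p_A=p_B=0$ nor $p_A=p_B=1$, and let $q_A=1-p_A$, $q_B=1-p_B$. If $A$ serves first in the set tie-breaker's tie-breaker, then the probability $\theta_{STT}(p_A,p_B)$ that $A$ wins it is $$\theta_{STT}(p_A,p_B)=\frac{OR(p_A,p_B)}{1+OR(p_A,p_B)},$$ and $$\theta_{STT}(p_A,p_B)=\theta_{STT}(q_B,q_A).$$ Furthermore, the result is invariant under permutation of the serving order within each successive odd/even pair of points.
   Context: Odds ratio: $OR(p_A,p_B)=\dfrac{p_A/q_A}{p_B/q_B}$; in boundary cases where this is not a finite well-defined number, the expression $\frac{OR(p_A,p_B)}{1+OR(p_A,p_B)}$ is read as $\frac{p_Aq_B}{p_Aq_B+q_Ap_B}$, with which it coincides otherwise. Players $A$ and $B$ play points; all point outcomes are independent. When $A$ serves a point, $A$ wins it with probability $p_A$ (and $B$ wins it otherwise); when $B$ serves a point, $B$ wins it with probability $p_B$ (and $A$ wins it otherwise). Set tie-breaker's tie-breaker (STT): starting from an even score, points are played with serving sequence $ABBAABBAA\ldots$ ($A$ serves points 1, 4, 5, 8, 9, $\ldots$; $B$ serves the others), until one player is ahead by two points for the first time; that player wins. In general $\theta_{STT}(x,y)$ is the probability that the first server wins the STT when the first server wins each point on own serve with probability $x$ and the other player wins each point on own serve with probability $y$. An odd/even pair of points consists of the points numbered $2m-1$ and $2m$, $m\ge1$; each player serves exactly one point of each pair, and a permutation of the serving order interchanges, in any chosen collection of these pairs, which point is served by $A$ and which by $B$. *)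

theory Defs
  imports "HOL-Probability.Probability"
begin

definition odds_ratio :: "real \<Rightarrow> real \<Rightarrow> real" where
  "odds_ratio pA pB = (pA / (1 - pA)) / (pB / (1 - pB))"

text \<open>
  The value of \<open>OR / (1 + OR)\<close>. The odds ratio is a finite well-defined number iff none of
  the three divisors \<open>1 - pA\<close>, \<open>1 - pB\<close>, \<open>pB / (1 - pB)\<close> vanishes; otherwise the ratio is read
  as the expression it reduces to after clearing denominators. (Without the case distinction,
  \<open>x / 0 = 0\<close> would give wrong values such as \<open>0\<close> at \<open>pA = 1\<close>.)
\<close>
definition odds_ratio_fraction :: "real \<Rightarrow> real \<Rightarrow> real" where
  "odds_ratio_fraction pA pB =
     (if pA \<noteq> 1 \<and> pB \<noteq> 1 \<and> pB \<noteq> 0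
      then odds_ratio pA pB / (1 + odds_ratio pA pB)
      else pA * (1 - pB) / (pA * (1 - pB) + (1 - pA) * pB))"

text \<open>
  Points are numbered from 1. A serving order \<open>s\<close> has \<open>s n\<close> true iff A serves point \<open>n\<close>
  (otherwise B does); an outcome \<open>\<omega>\<close> has \<open>\<omega> n\<close> true iff A wins point \<open>n\<close> (otherwise B does).
\<close>
definition ABBA_order :: "nat \<Rightarrow> bool" where
  "ABBA_order n \<longleftrightarrow> n mod 4 \<in> {0, 1}"

text \<open>Interchange the servers of the points \<open>2m - 1\<close> and \<open>2m\<close> for every \<open>m \<in> C\<close>.\<close>
definition swap_pairs :: "nat set \<Rightarrow> (nat \<Rightarrow> bool) \<Rightarrow> nat \<Rightarrow> bool" where
  "swap_pairs C s n =
     (if \<exists>m\<in>C. n = 2 * m - 1 then s (n + 1)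
      else if \<exists>m\<in>C. n = 2 * m then s (n - 1)
      else s n)"

definition points_A :: "(nat \<Rightarrow> bool) \<Rightarrow> nat \<Rightarrow> nat" where
  "points_A \<omega> n = card {k \<in> {1..n}. \<omega> k}"

definition points_B :: "(nat \<Rightarrow> bool) \<Rightarrow> nat \<Rightarrow> nat" where
  "points_B \<omega> n = card {k \<in> {1..n}. \<not> \<omega> k}"

definition A_wins_STT :: "(nat \<Rightarrow> bool) \<Rightarrow> bool" where
  "A_wins_STT \<omega> \<longleftrightarrow>
     (\<exists>n. points_A \<omega> n = points_B \<omega> n + 2 \<and>
          (\<forall>k<n. points_A \<omega> k \<noteq> points_B \<omega> k + 2 \<and> points_B \<omega> k \<noteq> points_A \<omega> k + 2))"

definition point_process :: "(nat \<Rightarrow> bool) \<Rightarrow> real \<Rightarrow> real \<Rightarrow> (nat \<Rightarrow> bool) measure" where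
  "point_process s pA pB =
     (\<Pi>\<^sub>M n\<in>{1..}. measure_pmf (bernoulli_pmf (if s n then pA else 1 - pB)))"

definition prob_A_wins_STT :: "(nat \<Rightarrow> bool) \<Rightarrow> real \<Rightarrow> real \<Rightarrow> real" where
  "prob_A_wins_STT s pA pB =
     measure (point_process s pA pB) {\<omega> \<in> space (point_process s pA pB). A_wins_STT \<omega>}"

text \<open>The probability that the first server wins: in \<open>ABBA_order\<close> that player is A.\<close>
definition theta_STT :: "real \<Rightarrow> real \<Rightarrow> real" where
  "theta_STT x y = prob_A_wins_STT ABBA_order x y"

end

theory Submission imports Defs begin

text \<open>
  The lead of A changes by one with every point, so from an even score a lead of two can only
  arise at the end of a pair of points \<open>2j + 1\<close>, \<open>2j + 2\<close>. A pair that the players split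
  restores the even score, and a pair taken by one player ends the game. Hence A wins iff, for
  some \<open>m\<close>, the first \<open>m\<close> pairs are split and A takes both points of the next one
  (\<open>A_wins_STT_iff_pair\<close>).

  If each player serves once in every pair, then whatever the order within the pair, A takes both
  points with probability \<open>pA * (1 - pB)\<close>, B takes both with probability \<open>(1 - pA) * pB\<close>, and the
  pair is split with the remaining probability \<open>r\<close>. Distinct pairs are independent, so A wins with
  probability \<open>(\<Sum>m. r ^ m) * (pA * (1 - pB))\<close>, that is
  \<open>pA * (1 - pB) / (pA * (1 - pB) + (1 - pA) * pB)\<close> (\<open>prob_A_wins_STT_eq\<close>). The excluded boundary
  cases are exactly those with \<open>r = 1\<close>, in which every pair is split almost surely and the game
  never ends.

  All three claims can be read off this formula. It is the odds ratio fraction; it is unchanged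
  when \<open>(pA, pB)\<close> is replaced by \<open>(1 - pB, 1 - pA)\<close>; and it holds for every serving order that
  gives each player one serve in each pair, a property that interchanges within pairs preserve.
\<close>

section \<open>The tie-breaker seen pair by pair\<close>

definition lead_A :: "(nat \<Rightarrow> bool) \<Rightarrow> nat \<Rightarrow> int" where
  "lead_A \<omega> n = int (points_A \<omega> n) - int (points_B \<omega> n)"

lemma lead_A_0: "lead_A \<omega> 0 = 0"
  by (simp add: lead_A_def points_A_def points_B_def)

lemma card_initial_Suc:
  "card {k \<in> {1..Suc n}. P k} = card {k \<in> {1..n}. P k} + (if P (Suc n) then 1 else 0)"
proof -
  have "{k \<in> {1..Suc n}. P k} =
      (if P (Suc n) then insert (Suc n) {k \<in> {1..n}. P k} else {k \<in> {1..n}. P k})"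
    by (auto simp: le_Suc_eq)
  then show ?thesis by simp
qed

lemma lead_A_Suc: "lead_A \<omega> (Suc n) = lead_A \<omega> n + (if \<omega> (Suc n) then 1 else - 1)"
  unfolding lead_A_def points_A_def points_B_def card_initial_Suc by simp

text \<open>
  The two stopping conditions, a lead of two for A and one for B, merge into the condition that
  the absolute lead is two.
\<close>

lemma A_wins_STT_iff_lead:
  "A_wins_STT \<omega> \<longleftrightarrow> (\<exists>n. lead_A \<omega> n = 2 \<and> (\<forall>k<n. \<bar>lead_A \<omega> k\<bar> \<noteq> 2))"
proof -
  have "points_A \<omega> n = points_B \<omega> n + 2 \<longleftrightarrow> lead_A \<omega> n = 2"
    "points_B \<omega> n = points_A \<omega> n + 2 \<longleftrightarrow> lead_A \<omega> n = - 2" for n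
    unfolding lead_A_def by linarith+
  moreover have "\<bar>x\<bar> \<noteq> 2 \<longleftrightarrow> x \<noteq> 2 \<and> x \<noteq> - 2" for x :: int by linarith
  ultimately show ?thesis unfolding A_wins_STT_def by presburger
qed

text \<open>Pairs are counted from \<open>0\<close>, so that pair \<open>m\<close> is preceded by exactly \<open>m\<close> pairs.\<close>

definition A_wins_in_pair :: "nat \<Rightarrow> (nat \<Rightarrow> bool) \<Rightarrow> bool" where
  "A_wins_in_pair m \<omega> \<longleftrightarrow>
     (\<forall>j<m. \<omega> (2 * j + 1) \<noteq> \<omega> (2 * j + 2)) \<and> \<omega> (2 * m + 1) \<and> \<omega> (2 * m + 2)"

lemma lead_A_after_split_pairs:
  assumes "\<forall>j<m. \<omega> (2 * j + 1) \<noteq> \<omega> (2 * j + 2)"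
  shows "lead_A \<omega> (2 * m) = 0"
  using assms by (induction m) (auto simp: lead_A_0 lead_A_Suc)

text \<open>
  No player can win while the pairs are being split, nor after the first point of the next pair:
  the lead vanishes after each split pair and is \<open>1\<close> or \<open>-1\<close> in the middle of a pair.
\<close>

lemma lead_A_small_during_split_pairs:
  assumes split: "\<forall>j<m. \<omega> (2 * j + 1) \<noteq> \<omega> (2 * j + 2)" and k: "k < 2 * m + 2"
  shows "\<bar>lead_A \<omega> k\<bar> \<noteq> 2"
proof -
  have even: "lead_A \<omega> (2 * j) = 0" if "j \<le> m" for j
    using split that by (intro lead_A_after_split_pairs) auto
  have "k = 2 * (k div 2) \<or> k = Suc (2 * (k div 2))" by presburger
  moreover have "lead_A \<omega> (2 * (k div 2)) = 0" using k by (intro even) linarith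
  ultimately show ?thesis
    using lead_A_Suc[of \<omega> "2 * (k div 2)"] by (auto split: if_splits)
qed

text \<open>
  The first pair that is not split decides the game, and it decides it for the player who takes it.
\<close>

lemma A_wins_STT_iff_pair: "A_wins_STT \<omega> \<longleftrightarrow> (\<exists>m. A_wins_in_pair m \<omega>)"
proof
  assume "\<exists>m. A_wins_in_pair m \<omega>"
  then obtain m where split: "\<forall>j<m. \<omega> (2 * j + 1) \<noteq> \<omega> (2 * j + 2)"
    and both: "\<omega> (2 * m + 1)" "\<omega> (2 * m + 2)"
    by (auto simp: A_wins_in_pair_def)
  have "lead_A \<omega> (2 * m + 2) = 2"
    using both lead_A_after_split_pairs[OF split] by (simp add: lead_A_Suc)
  then show "A_wins_STT \<omega>"
    using lead_A_small_during_split_pairs[OF split] by (auto simp: A_wins_STT_iff_lead)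
next
  assume "A_wins_STT \<omega>"
  then obtain n where n: "lead_A \<omega> n = 2" and first: "\<forall>k<n. \<bar>lead_A \<omega> k\<bar> \<noteq> 2"
    by (auto simp: A_wins_STT_iff_lead)
  have "\<exists>j. \<omega> (2 * j + 1) = \<omega> (2 * j + 2)"
  proof (rule ccontr)
    assume "\<not> ?thesis"
    then have "\<bar>lead_A \<omega> n\<bar> \<noteq> 2"
      by (intro lead_A_small_during_split_pairs[of n]) auto
    with n show False by simp
  qed
  \<comment> \<open>The decisive pair is the first one that is not split.\<close>
  then obtain m where m: "\<omega> (2 * m + 1) = \<omega> (2 * m + 2)"
    and split: "\<forall>j<m. \<omega> (2 * j + 1) \<noteq> \<omega> (2 * j + 2)"
    using exists_least_iff[of "\<lambda>j. \<omega> (2 * j + 1) = \<omega> (2 * j + 2)"] by auto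
  have "\<omega> (2 * m + 1)"
  proof (rule ccontr)
    \<comment> \<open>Otherwise B is two ahead before A is, and the game has ended by then.\<close>
    assume "\<not> \<omega> (2 * m + 1)"
    with m have lost: "lead_A \<omega> (2 * m + 2) = - 2"
      using lead_A_after_split_pairs[OF split] by (simp add: lead_A_Suc)
    have "\<not> n < 2 * m + 2" using lead_A_small_during_split_pairs[OF split, of n] n by auto
    moreover have "n \<noteq> 2 * m + 2" using n lost by auto
    ultimately have "2 * m + 2 < n" by simp
    with first have "\<bar>lead_A \<omega> (2 * m + 2)\<bar> \<noteq> 2" by blast
    with lost show False by simp
  qed
  with m split show "\<exists>m. A_wins_in_pair m \<omega>" by (auto simp: A_wins_in_pair_def)
qed

section \<open>Independence of the pairs\<close>

lemma prob_space_point_process: "prob_space (point_process s pA pB)"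
  unfolding point_process_def by (intro prob_space_PiM prob_space_measure_pmf)

lemma measurable_point [measurable]:
  "n \<ge> 1 \<Longrightarrow> (\<lambda>\<omega>. \<omega> n) \<in> measurable (point_process s pA pB) (count_space UNIV)"
  unfolding point_process_def
  by (rule measurable_compose[OF measurable_component_singleton]) auto

lemma distr_point:
  assumes "n \<ge> 1"
  shows "distr (point_process s pA pB) (count_space UNIV) (\<lambda>\<omega>. \<omega> n) =
    measure_pmf (bernoulli_pmf (if s n then pA else 1 - pB))"
proof -
  let ?M = "\<lambda>n. measure_pmf (bernoulli_pmf (if s n then pA else 1 - pB))"
  have "distr (PiM {1..} ?M) (count_space UNIV) (\<lambda>\<omega>. \<omega> n) = distr (PiM {1..} ?M) (?M n) (\<lambda>\<omega>. \<omega> n)"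
    by (intro distr_cong) auto
  also have "\<dots> = ?M n"
    using assms by (intro distr_PiM_component) (auto intro: prob_space_measure_pmf)
  finally show ?thesis unfolding point_process_def .
qed

lemma prob_point:
  assumes "n \<ge> 1" "pA \<in> {0..1}" "pB \<in> {0..1}"
  shows "measure (point_process s pA pB) ((\<lambda>\<omega>. \<omega> n) -` {a} \<inter> space (point_process s pA pB)) =
    (if a = s n then (if a then pA else pB) else (if a then 1 - pB else 1 - pA))"
proof -
  have "measure (point_process s pA pB) ((\<lambda>\<omega>. \<omega> n) -` {a} \<inter> space (point_process s pA pB)) =
      measure (measure_pmf (bernoulli_pmf (if s n then pA else 1 - pB))) {a}"
    using assms(1) by (subst distr_point[symmetric]) (auto simp: measure_distr)
  also have "\<dots> = pmf (bernoulli_pmf (if s n then pA else 1 - pB)) a"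
    by (rule measure_pmf_single)
  finally show ?thesis using assms by (cases a; cases "s n") auto
qed

text \<open>
  Independence of the coordinates means that their joint distribution is the product of their
  distributions. Here the joint distribution is the point process itself, which is a product
  measure.
\<close>

lemma indep_points:
  "prob_space.indep_vars (point_process s pA pB) (\<lambda>_. count_space UNIV) (\<lambda>n \<omega>. \<omega> n) {1..}"
proof -
  interpret prob_space "point_process s pA pB" by (rule prob_space_point_process)
  let ?M = "\<lambda>n. measure_pmf (bernoulli_pmf (if s n then pA else 1 - pB))"
  have sets: "sets (point_process s pA pB) = sets (\<Pi>\<^sub>M n\<in>{1..}. count_space UNIV)"
    unfolding point_process_def by (intro sets_PiM_cong) auto
  have "distr (point_process s pA pB) (\<Pi>\<^sub>M n\<in>{1..}. count_space UNIV) (\<lambda>\<omega>. \<lambda>n\<in>{1..}. \<omega> n)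
      = distr (point_process s pA pB) (point_process s pA pB) (\<lambda>\<omega>. \<omega>)"
    by (intro distr_cong sets[symmetric])
      (auto simp: point_process_def space_PiM PiE_restrict)
  also have "\<dots> = point_process s pA pB" by (rule distr_id)
  also have "\<dots> = (\<Pi>\<^sub>M n\<in>{1..}. distr (point_process s pA pB) (count_space UNIV) (\<lambda>\<omega>. \<omega> n))"
    unfolding point_process_def[of s pA pB]
    by (intro PiM_cong refl, subst distr_point[unfolded point_process_def]) auto
  finally show ?thesis
    by (subst indep_vars_iff_distr_eq_PiM') auto
qed

text \<open>
  As \<open>bool\<close> is finite, the product of two discrete spaces on it is the discrete space on the pairs.
\<close>

lemma measurable_pair_bool:
  fixes f g :: "'a \<Rightarrow> bool"
  assumes "f \<in> measurable M (count_space UNIV)" "g \<in> measurable M (count_space UNIV)"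
  shows "(\<lambda>x. (f x, g x)) \<in> measurable M (count_space UNIV)"
  using measurable_Pair[OF assms] by (simp add: pair_measure_count_space)

text \<open>
  Functions of disjoint blocks of independent variables are independent; the pairs are the blocks.
\<close>

lemma indep_pairs:
  "prob_space.indep_vars (point_process s pA pB) (\<lambda>_. count_space UNIV)
     (\<lambda>j \<omega>. (\<omega> (2 * j + 1), \<omega> (2 * j + 2))) UNIV"
proof -
  interpret prob_space "point_process s pA pB" by (rule prob_space_point_process)
  let ?K = "\<lambda>j::nat. {2 * j + 1, 2 * j + 2}"
  have "disjoint_family_on ?K UNIV"
    unfolding disjoint_family_on_def by auto
  then have "indep_vars (\<lambda>j. PiM (?K j) (\<lambda>_. count_space UNIV))
      (\<lambda>j \<omega>. restrict (\<lambda>n. \<omega> n) (?K j)) UNIV"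
    by (intro indep_vars_restrict[OF indep_points]) auto
  then have "indep_vars (\<lambda>_. count_space UNIV)
      (\<lambda>j \<omega>. (\<lambda>f. (f (2 * j + 1), f (2 * j + 2))) (restrict (\<lambda>n. \<omega> n) (?K j))) UNIV"
    by (rule indep_vars_compose2) (intro measurable_pair_bool measurable_component_singleton; simp)
  then show ?thesis by simp
qed

lemma prob_pair:
  "measure (point_process s pA pB)
      ((\<lambda>\<omega>. (\<omega> (2 * j + 1), \<omega> (2 * j + 2))) -` {(a, b)} \<inter> space (point_process s pA pB)) =
    measure (point_process s pA pB)
      ((\<lambda>\<omega>. \<omega> (2 * j + 1)) -` {a} \<inter> space (point_process s pA pB)) *
    measure (point_process s pA pB)
      ((\<lambda>\<omega>. \<omega> (2 * j + 2)) -` {b} \<inter> space (point_process s pA pB))"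
proof -
  interpret prob_space "point_process s pA pB" by (rule prob_space_point_process)
  let ?J = "{2 * j + 1, 2 * j + 2}" and ?\<Omega> = "space (point_process s pA pB)"
  let ?A = "\<lambda>n. if n = 2 * j + 1 then {a} else {b}"
  have "prob (\<Inter>n\<in>?J. (\<lambda>\<omega>. \<omega> n) -` ?A n \<inter> ?\<Omega>) = (\<Prod>n\<in>?J. prob ((\<lambda>\<omega>. \<omega> n) -` ?A n \<inter> ?\<Omega>))"
    by (rule indep_varsD[OF indep_points]) auto
  moreover have "(\<Inter>n\<in>?J. (\<lambda>\<omega>. \<omega> n) -` ?A n \<inter> ?\<Omega>) =
      (\<lambda>\<omega>. (\<omega> (2 * j + 1), \<omega> (2 * j + 2))) -` {(a, b)} \<inter> ?\<Omega>"
    by auto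
  ultimately show ?thesis by simp
qed

section \<open>The winning probability\<close>

definition each_serves_once_per_pair :: "(nat \<Rightarrow> bool) \<Rightarrow> bool" where
  "each_serves_once_per_pair s \<longleftrightarrow> (\<forall>j. s (2 * j + 1) \<noteq> s (2 * j + 2))"

text \<open>
  Which of the two points A serves is immaterial: A holds the own serve with probability \<open>pA\<close> and
  breaks the serve of B with probability \<open>1 - pB\<close>, and multiplication commutes.
\<close>

lemma prob_A_takes_both:
  assumes "pA \<in> {0..1}" "pB \<in> {0..1}" "each_serves_once_per_pair s"
  shows "measure (point_process s pA pB)
      ((\<lambda>\<omega>. (\<omega> (2 * j + 1), \<omega> (2 * j + 2))) -` {(True, True)} \<inter> space (point_process s pA pB)) =
    pA * (1 - pB)"
proof -
  have "s (2 * j + 1) \<noteq> s (2 * j + 2)" using assms(3) by (simp add: each_serves_once_per_pair_def)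
  then show ?thesis
    using assms(1,2) unfolding prob_pair by (auto simp: prob_point)
qed

text \<open>
  A pair is split if both servers win or both servers lose their point, again whoever serves first.
\<close>

lemma prob_split_pair:
  assumes "pA \<in> {0..1}" "pB \<in> {0..1}" "each_serves_once_per_pair s"
  shows "measure (point_process s pA pB)
      ((\<lambda>\<omega>. (\<omega> (2 * j + 1), \<omega> (2 * j + 2))) -` {(a, b). a \<noteq> b} \<inter> space (point_process s pA pB)) =
    pA * pB + (1 - pA) * (1 - pB)"
proof -
  interpret prob_space "point_process s pA pB" by (rule prob_space_point_process)
  let ?X = "\<lambda>\<omega>::nat \<Rightarrow> bool. (\<omega> (2 * j + 1), \<omega> (2 * j + 2))"
  let ?E = "\<lambda>A. ?X -` A \<inter> space (point_process s pA pB)"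
  have s: "s (2 * j + 1) \<noteq> s (2 * j + 2)" using assms(3) by (simp add: each_serves_once_per_pair_def)
  have X: "?X \<in> measurable (point_process s pA pB) (count_space UNIV)"
    using indep_pairs by (auto simp: indep_vars_def)
  have "?E {(a, b). a \<noteq> b} = ?E {(True, False)} \<union> ?E {(False, True)}" by auto
  then have "prob (?E {(a, b). a \<noteq> b}) = prob (?E {(True, False)}) + prob (?E {(False, True)})"
    using measurable_sets[OF X] by (simp only:) (intro finite_measure_Union; auto)
  then show ?thesis
    using s assms(1,2) unfolding prob_pair
    by (auto simp: prob_point algebra_simps)
qed

text \<open>
  Writing the event as an intersection with one condition per pair makes the independence of the
  pairs applicable.
\<close>

lemma A_wins_in_pair_event:
  "{\<omega> \<in> \<Omega>. A_wins_in_pair m \<omega>} =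
    (\<Inter>j\<in>{..m}. (\<lambda>\<omega>. (\<omega> (2 * j + 1), \<omega> (2 * j + 2))) -`
       (if j < m then {(a, b). a \<noteq> b} else {(True, True)}) \<inter> \<Omega>)"
proof -
  have "A_wins_in_pair m \<omega> \<longleftrightarrow> (\<forall>j\<le>m. (\<omega> (2 * j + 1), \<omega> (2 * j + 2)) \<in>
      (if j < m then {(a, b). a \<noteq> b} else {(True, True)}))" for \<omega>
    unfolding A_wins_in_pair_def le_less by auto
  then show ?thesis by fastforce
qed

lemma A_wins_in_pair_measurable:
  "{\<omega> \<in> space (point_process s pA pB). A_wins_in_pair m \<omega>} \<in> sets (point_process s pA pB)"
proof -
  interpret prob_space "point_process s pA pB" by (rule prob_space_point_process)
  show ?thesis
    unfolding A_wins_in_pair_event using indep_pairs[of s pA pB]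
    by (intro sets.finite_INT) (auto simp: indep_vars_def intro!: measurable_sets)
qed

lemma prob_A_wins_in_pair:
  assumes "pA \<in> {0..1}" "pB \<in> {0..1}" "each_serves_once_per_pair s"
  shows "measure (point_process s pA pB)
      {\<omega> \<in> space (point_process s pA pB). A_wins_in_pair m \<omega>} =
    (pA * pB + (1 - pA) * (1 - pB)) ^ m * (pA * (1 - pB))"
proof -
  interpret prob_space "point_process s pA pB" by (rule prob_space_point_process)
  let ?E = "\<lambda>j A. (\<lambda>\<omega>. (\<omega> (2 * j + 1), \<omega> (2 * j + 2))) -` A \<inter> space (point_process s pA pB)"
  let ?A = "\<lambda>j. if j < m then {(a, b). a \<noteq> b} else {(True, True)}"
  have "prob {\<omega> \<in> space (point_process s pA pB). A_wins_in_pair m \<omega>} =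
      (\<Prod>j\<in>{..m}. prob (?E j (?A j)))"
    unfolding A_wins_in_pair_event by (rule indep_varsD[OF indep_pairs]) auto
  also have "\<dots> = (\<Prod>j\<in>{..<m}. prob (?E j (?A j))) * prob (?E m (?A m))"
    by (simp add: lessThan_Suc_atMost[symmetric])
  also have "\<dots> = (pA * pB + (1 - pA) * (1 - pB)) ^ m * (pA * (1 - pB))"
    using prob_split_pair[OF assms] prob_A_takes_both[OF assms] by simp
  finally show ?thesis .
qed

text \<open>
  The events that A wins in pair \<open>m\<close> are disjoint, since the deciding pair is not split, and their
  probabilities form a geometric series. Its ratio is below \<open>1\<close> because a pair decides the game
  with positive probability.
\<close>

lemma prob_A_wins_STT_eq:
  assumes "pA \<in> {0..1}" "pB \<in> {0..1}" "each_serves_once_per_pair s"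
    and decisive: "pA * (1 - pB) + (1 - pA) * pB > 0"
  shows "prob_A_wins_STT s pA pB = pA * (1 - pB) / (pA * (1 - pB) + (1 - pA) * pB)"
proof -
  interpret prob_space "point_process s pA pB" by (rule prob_space_point_process)
  let ?W = "\<lambda>m. {\<omega> \<in> space (point_process s pA pB). A_wins_in_pair m \<omega>}"
  define r where "r = pA * pB + (1 - pA) * (1 - pB)"
  have one_minus_r: "1 - r = pA * (1 - pB) + (1 - pA) * pB"
    by (simp add: r_def algebra_simps)
  have "0 \<le> r" using assms(1,2) by (simp add: r_def)
  moreover have "r < 1" using one_minus_r decisive by simp
  ultimately have "(\<lambda>m. r ^ m * (pA * (1 - pB))) sums (1 / (1 - r) * (pA * (1 - pB)))"
    by (intro sums_mult2 geometric_sums) simp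
  then have "(\<lambda>m. prob (?W m)) sums (pA * (1 - pB) / (pA * (1 - pB) + (1 - pA) * pB))"
    unfolding prob_A_wins_in_pair[OF assms(1,2,3)] one_minus_r[symmetric]
    by (simp add: r_def)
  moreover have "disjoint_family ?W"
    unfolding disjoint_family_on_def A_wins_in_pair_def using nat_neq_iff by blast
  then have "(\<lambda>m. prob (?W m)) sums prob (\<Union>m. ?W m)"
    using A_wins_in_pair_measurable by (intro finite_measure_UNION) auto
  moreover have "(\<Union>m. ?W m) = {\<omega> \<in> space (point_process s pA pB). A_wins_STT \<omega>}"
    by (auto simp: A_wins_STT_iff_pair)
  ultimately show ?thesis
    unfolding prob_A_wins_STT_def by (simp add: sums_unique2)
qed

section \<open>Serving orders and the odds ratio\<close>

lemma each_serves_once_ABBA: "each_serves_once_per_pair ABBA_order"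
  unfolding each_serves_once_per_pair_def
proof
  fix j :: nat
  have "(2 * j) mod 4 = 0 \<or> (2 * j) mod 4 = 2" by presburger
  then show "ABBA_order (2 * j + 1) \<noteq> ABBA_order (2 * j + 2)"
    unfolding ABBA_order_def mod_add_left_eq[of "2 * j" 4, symmetric] by auto
qed

text \<open>
  The pair of the points \<open>2j + 1\<close> and \<open>2j + 2\<close> is the one that \<open>C\<close> records as \<open>Suc j\<close>, and an
  interchange only swaps two servers that differ.
\<close>

lemma each_serves_once_swap:
  assumes "each_serves_once_per_pair s" "C \<subseteq> {1..}"
  shows "each_serves_once_per_pair (swap_pairs C s)"
proof -
  have "(\<exists>m\<in>C. 2 * j + 1 = 2 * m - 1) \<longleftrightarrow> Suc j \<in> C"
    "(\<exists>m\<in>C. 2 * j + 2 = 2 * m) \<longleftrightarrow> Suc j \<in> C"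
    "\<not> (\<exists>m\<in>C. 2 * j + 2 = 2 * m - 1)" "\<not> (\<exists>m\<in>C. 2 * j + 1 = 2 * m)" for j
  proof -
    have *: "2 * j + 1 = 2 * m - 1 \<longleftrightarrow> m = Suc j" "2 * j + 2 = 2 * m \<longleftrightarrow> m = Suc j"
      "2 * j + 2 \<noteq> 2 * m - 1" "2 * j + 1 \<noteq> 2 * m" if "m \<in> C" for m
      using that assms(2) by (auto, presburger+)
    show "(\<exists>m\<in>C. 2 * j + 1 = 2 * m - 1) \<longleftrightarrow> Suc j \<in> C"
      "(\<exists>m\<in>C. 2 * j + 2 = 2 * m) \<longleftrightarrow> Suc j \<in> C"
      "\<not> (\<exists>m\<in>C. 2 * j + 2 = 2 * m - 1)" "\<not> (\<exists>m\<in>C. 2 * j + 1 = 2 * m)"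
      using * by metis+
  qed
  then show ?thesis
    using assms(1) unfolding each_serves_once_per_pair_def swap_pairs_def by auto
qed

text \<open>
  Where the odds ratio is a finite number, expanding \<open>OR / (1 + OR)\<close> by the nonzero number
  \<open>(1 - pA) * pB\<close> clears the denominators.
\<close>

lemma odds_ratio_fraction_eq:
  "odds_ratio_fraction pA pB = pA * (1 - pB) / (pA * (1 - pB) + (1 - pA) * pB)"
proof (cases "pA \<noteq> 1 \<and> pB \<noteq> 1 \<and> pB \<noteq> 0")
  case True
  define d where "d = (1 - pA) * pB"
  have d: "d \<noteq> 0" using True by (simp add: d_def)
  have "odds_ratio pA pB = pA * (1 - pB) / d"
    using True by (simp add: odds_ratio_def d_def)
  then have "odds_ratio pA pB / (1 + odds_ratio pA pB) = pA * (1 - pB) / d / ((pA * (1 - pB) + d) / d)"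
    using d by (simp add: add_divide_distrib add.commute)
  then show ?thesis using True d by (simp add: odds_ratio_fraction_def d_def)
qed (auto simp: odds_ratio_fraction_def)

theorem proposition3p2:
  fixes pA pB qA qB :: real
  assumes "pA \<in> {0..1}" and "pB \<in> {0..1}"
    and "\<not> (pA = 0 \<and> pB = 0)" and "\<not> (pA = 1 \<and> pB = 1)"
    and "qA = 1 - pA" and "qB = 1 - pB"
  shows "theta_STT pA pB = odds_ratio_fraction pA pB
    \<and> theta_STT pA pB = theta_STT qB qA
    \<and> (\<forall>C. C \<subseteq> {1..} \<longrightarrow>
          prob_A_wins_STT (swap_pairs C ABBA_order) pA pB = theta_STT pA pB)"
proof -
  have decisive: "pA * (1 - pB) + (1 - pA) * pB > 0"
  proof -
    have "0 \<le> pA * (1 - pB)" "0 \<le> (1 - pA) * pB" using assms(1,2) by simp_all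
    moreover have "pA * (1 - pB) \<noteq> 0 \<or> (1 - pA) * pB \<noteq> 0" using assms(3,4) by auto
    ultimately show ?thesis by linarith
  qed
  have q: "qA \<in> {0..1}" "qB \<in> {0..1}" using assms by auto
  have val: "prob_A_wins_STT s pA pB = pA * (1 - pB) / (pA * (1 - pB) + (1 - pA) * pB)"
    if "each_serves_once_per_pair s" for s
    using prob_A_wins_STT_eq[OF assms(1,2) that decisive] .
  have "theta_STT qB qA = qB * (1 - qA) / (qB * (1 - qA) + (1 - qB) * qA)"
    unfolding theta_STT_def using decisive assms(5,6)
    by (intro prob_A_wins_STT_eq q each_serves_once_ABBA) (simp add: mult.commute)
  also have "\<dots> = pA * (1 - pB) / (pA * (1 - pB) + (1 - pA) * pB)"
    using assms(5,6) by (simp add: mult.commute)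
  finally show ?thesis
    using val each_serves_once_ABBA each_serves_once_swap odds_ratio_fraction_eq
    by (simp add: theta_STT_def)
qed

end
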